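(* Let $R$ be a complete discrete valuation ring whose fraction field $K$ has characteristic different from $2$, with normalized valuation $v:K^{\times}\to\mathbb{Z}$. Let $a\geq 2$ be an integer and endow $R$ with the norm $|x|_a=a^{v(x)}$ for $x \neq 0$, $|0|_a=0$. Let $q(x_1,\ldots,x_n)$ be a quadratic form over $R$, nondegenerate over $K$. Then $q$ is Euclidean for the norm $|\cdot|_a$ if and only if the corresponding quadratic $R$-lattice $\Lambda=R^n$ in $(K^n,q)$ is maximal.
   Context: The norm $|\cdot|_a$ is extended to $K$ by the same formula $|x|_a=a^{v(x)}$ (note the positive exponent, so elements $x \in K\setminus R$ have $|x|_a<1$). A quadratic form over $R$ is a homogeneous polynomial $q\in R[x_1,\ldots,x_n]$ of degree $2$. A quadratic form $q$ over a domain $R$ with multiplicative norm $|\cdot|$ is Euclidean if for all $x\in K^n\setminus R^n$ there exists $y\in R^n$ such that $0<|q(x-y)|<1$. Let $V$ be a finite-dimensional $K$-vector space with a quadratic form $q:V\to K$. An $R$-lattice in $V$ is a finitely generated $R$-submodule $\Lambda$ of $V$ with $\Lambda\otimes_R K=V$. A quadratic $R$-lattice in $(V,q)$ is an $R$-lattice $\Lambda$ with $q(\Lambda)\subset R$. It is maximal if it is not strictly contained in another quadratic $R$-lattice in $(V,q)$. A quadratic form $q$ over $R$ in $n$ variables gives the quadratic $R$-lattice $R^n\subset K^n$. *)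

theory Defs
  imports
    "HOL-Analysis.Analysis"
    "HOL-Computational_Algebra.Computational_Algebra"
    "HOL-Library.Poly_Mapping"
begin

text \<open>
  The ring \<open>R\<close> is an integral domain type \<open>'r\<close> and its fraction field \<open>K\<close> is \<open>'r fract\<close>.
  A valuation is defined on the nonzero elements of \<open>K\<close> only; the value \<open>v 0\<close> is junk and every
  definition below avoids it.
\<close>

definition normalized_discrete_valuation :: "('k::field \<Rightarrow> int) \<Rightarrow> bool" where
  "normalized_discrete_valuation v \<longleftrightarrow>
     v ` (- {0}) = UNIV \<and>
     (\<forall>x y. x \<noteq> 0 \<longrightarrow> y \<noteq> 0 \<longrightarrow> v (x * y) = v x + v y) \<and>
     (\<forall>x y. x \<noteq> 0 \<longrightarrow> y \<noteq> 0 \<longrightarrow> x + y \<noteq> 0 \<longrightarrow> v (x + y) \<ge> min (v x) (v y))"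

definition valuation_ring :: "('k::field \<Rightarrow> int) \<Rightarrow> 'k set" where
  "valuation_ring v = {x. x = 0 \<or> v x \<ge> 0}"

definition integral_elements :: "'r::idom fract set" where
  "integral_elements = range to_fract"

definition discrete_valuation_ring :: "('r::idom fract \<Rightarrow> int) \<Rightarrow> bool" where
  "discrete_valuation_ring v \<longleftrightarrow>
     normalized_discrete_valuation v \<and> valuation_ring v = integral_elements"

definition valuation_ge :: "('k::field \<Rightarrow> int) \<Rightarrow> int \<Rightarrow> 'k \<Rightarrow> bool" where
  "valuation_ge v k x \<longleftrightarrow> x = 0 \<or> v x \<ge> k"

definition valuation_Cauchy :: "('r::idom fract \<Rightarrow> int) \<Rightarrow> (nat \<Rightarrow> 'r) \<Rightarrow> bool" where
  "valuation_Cauchy v f \<longleftrightarrow>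
     (\<forall>k. \<exists>N. \<forall>m\<ge>N. \<forall>n\<ge>N. valuation_ge v k (to_fract (f m - f n)))"

definition valuation_converges :: "('r::idom fract \<Rightarrow> int) \<Rightarrow> (nat \<Rightarrow> 'r) \<Rightarrow> 'r \<Rightarrow> bool" where
  "valuation_converges v f l \<longleftrightarrow>
     (\<forall>k. \<exists>N. \<forall>n\<ge>N. valuation_ge v k (to_fract (f n - l)))"

definition complete_discrete_valuation_ring :: "('r::idom fract \<Rightarrow> int) \<Rightarrow> bool" where
  "complete_discrete_valuation_ring v \<longleftrightarrow>
     discrete_valuation_ring v \<and>
     (\<forall>f. valuation_Cauchy v f \<longrightarrow> (\<exists>l. valuation_converges v f l))"

text \<open>The exponent is \<open>v x\<close>, not \<open>- v x\<close>: this is not the usual absolute value attached to \<open>v\<close>.\<close>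

definition valuation_norm :: "int \<Rightarrow> ('k::field \<Rightarrow> int) \<Rightarrow> 'k \<Rightarrow> real" where
  "valuation_norm a v x = (if x = 0 then 0 else of_int a powi v x)"

text \<open>
  A polynomial over \<open>'r\<close> in variables indexed by the finite type \<open>'n\<close> is a finitely supported
  function from exponent vectors \<open>'n \<Rightarrow>\<^sub>0 nat\<close> to coefficients.
\<close>

type_synonym ('n, 'r) polynomial = "('n \<Rightarrow>\<^sub>0 nat) \<Rightarrow>\<^sub>0 'r"

definition homogeneous_of_degree :: "nat \<Rightarrow> ('n::finite, 'r::zero) polynomial \<Rightarrow> bool" where
  "homogeneous_of_degree d q \<longleftrightarrow>
     (\<forall>m \<in> Poly_Mapping.keys q. (\<Sum>i\<in>UNIV. Poly_Mapping.lookup m i) = d)"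

definition quadratic_form :: "('n::finite, 'r::zero) polynomial \<Rightarrow> bool" where
  "quadratic_form q \<longleftrightarrow> homogeneous_of_degree 2 q"

definition eval_fract :: "('n::finite, 'r::idom) polynomial \<Rightarrow> 'r fract ^ 'n \<Rightarrow> 'r fract" where
  "eval_fract q x =
     (\<Sum>m \<in> Poly_Mapping.keys q.
        to_fract (Poly_Mapping.lookup q m) * (\<Prod>i\<in>UNIV. (x $ i) ^ Poly_Mapping.lookup m i))"

definition polar_form :: "('k::field ^ 'n \<Rightarrow> 'k) \<Rightarrow> 'k ^ 'n \<Rightarrow> 'k ^ 'n \<Rightarrow> 'k" where
  "polar_form Q x y = Q (x + y) - Q x - Q y"

definition nondegenerate :: "('k::field ^ 'n \<Rightarrow> 'k) \<Rightarrow> bool" where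
  "nondegenerate Q \<longleftrightarrow> (\<forall>x. (\<forall>y. polar_form Q x y = 0) \<longrightarrow> x = 0)"

definition standard_lattice :: "('r::idom fract ^ 'n) set" where
  "standard_lattice = {x. \<forall>i. x $ i \<in> integral_elements}"

definition Euclidean_form ::
    "('r::idom fract \<Rightarrow> real) \<Rightarrow> ('n::finite, 'r) polynomial \<Rightarrow> bool" where
  "Euclidean_form N q \<longleftrightarrow>
     (\<forall>x. x \<notin> standard_lattice \<longrightarrow>
        (\<exists>y \<in> standard_lattice. 0 < N (eval_fract q (x - y)) \<and> N (eval_fract q (x - y)) < 1))"

definition fract_scale :: "'r::idom \<Rightarrow> 'r fract ^ 'n \<Rightarrow> 'r fract ^ 'n" where
  "fract_scale r x = to_fract r *s x"

interpretation fract_module: module "fract_scale :: 'r::idom \<Rightarrow> 'r fract ^ 'n \<Rightarrow> 'r fract ^ 'n"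
  by unfold_locales (simp_all add: fract_scale_def vec_eq_iff algebra_simps)

text \<open>
  For an \<open>R\<close>-submodule \<open>L\<close> of \<open>V\<close> the map \<open>L \<otimes> K \<rightarrow> V\<close> is injective because \<open>L\<close> is torsion-free,
  so \<open>L \<otimes> K = V\<close> says that \<open>L\<close> spans \<open>V\<close> over \<open>K\<close>. Submodules are the library's \<open>subspace\<close>.
\<close>

definition lattice_in :: "('r::idom fract ^ 'n::finite) set \<Rightarrow> bool" where
  "lattice_in L \<longleftrightarrow>
     fract_module.subspace L \<and>
     (\<exists>S. finite S \<and> fract_module.span S = L) \<and>
     vec.span L = UNIV"

definition quadratic_lattice ::
    "('r::idom fract ^ 'n::finite \<Rightarrow> 'r fract) \<Rightarrow> ('r fract ^ 'n) set \<Rightarrow> bool" where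
  "quadratic_lattice Q L \<longleftrightarrow> lattice_in L \<and> Q ` L \<subseteq> integral_elements"

definition maximal_quadratic_lattice ::
    "('r::idom fract ^ 'n::finite \<Rightarrow> 'r fract) \<Rightarrow> ('r fract ^ 'n) set \<Rightarrow> bool" where
  "maximal_quadratic_lattice Q L \<longleftrightarrow>
     quadratic_lattice Q L \<and> \<not> (\<exists>L'. quadratic_lattice Q L' \<and> L \<subset> L')"

end

theory Submission
  imports Defs
begin

text \<open>
  Since \<open>a \<ge> 2\<close>, the condition \<open>0 < a powi v z < 1\<close> for \<open>z \<noteq> 0\<close> says \<open>v z < 0\<close>, so an element of
  \<open>K\<close> has norm strictly between \<open>0\<close> and \<open>1\<close> exactly when it lies outside \<open>R\<close>
  (\<open>valuation_norm_between_0_1_iff\<close>). Hence \<open>q\<close> is Euclidean if and only if every \<open>x \<notin> \<Lambda>\<close> has some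
  \<open>y \<in> \<Lambda>\<close> with \<open>q (x - y) \<notin> R\<close>. This is maximality of \<open>\<Lambda>\<close>, over any domain
  (\<open>maximal_standard_lattice_iff\<close>). If \<open>\<Lambda>\<close> is strictly contained in a quadratic lattice \<open>L\<close>, then an
  \<open>x \<in> L - \<Lambda>\<close> satisfies \<open>q (x - y) \<in> R\<close> for all \<open>y \<in> \<Lambda>\<close>. Conversely, let \<open>x \<notin> \<Lambda>\<close> satisfy
  \<open>q (x - y) \<in> R\<close> for all \<open>y \<in> \<Lambda>\<close>. Then \<open>q x \<in> R\<close>, and the values \<open>b y x\<close> of the polar form are
  in \<open>R\<close> because \<open>b y x = q y + q x - q (x - y)\<close>. So \<open>q (y + r x) = q y + r b y x + r\<^sup>2 q x\<close> is in
  \<open>R\<close> for all \<open>y \<in> \<Lambda>\<close> and \<open>r \<in> R\<close>, and \<open>\<Lambda> + R x\<close> is a strictly larger quadratic lattice.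
\<close>

section \<open>The subring of integral elements\<close>

lemma integral_elements_0 [simp]: "0 \<in> integral_elements"
  and integral_elements_1 [simp]: "1 \<in> integral_elements"
  and to_fract_in_integral_elements [simp]: "to_fract r \<in> integral_elements"
  unfolding integral_elements_def by (auto intro: range_eqI[of _ _ 0] range_eqI[of _ _ 1])

lemma integral_elements_add:
  "x \<in> integral_elements \<Longrightarrow> y \<in> integral_elements \<Longrightarrow> x + y \<in> integral_elements"
  unfolding integral_elements_def by (auto simp flip: to_fract_add)

lemma integral_elements_diff:
  "x \<in> integral_elements \<Longrightarrow> y \<in> integral_elements \<Longrightarrow> x - y \<in> integral_elements"
  unfolding integral_elements_def by (auto simp flip: to_fract_diff)

lemma integral_elements_mult:
  "x \<in> integral_elements \<Longrightarrow> y \<in> integral_elements \<Longrightarrow> x * y \<in> integral_elements"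
  unfolding integral_elements_def by (auto simp flip: to_fract_mult)

lemma integral_elements_power: "x \<in> integral_elements \<Longrightarrow> x ^ n \<in> integral_elements"
  by (induction n) (auto intro: integral_elements_mult)

lemma integral_elements_sum:
  "(\<And>i. i \<in> A \<Longrightarrow> f i \<in> integral_elements) \<Longrightarrow> sum f A \<in> integral_elements"
  by (induction A rule: infinite_finite_induct) (auto intro: integral_elements_add)

lemma integral_elements_prod:
  "(\<And>i. i \<in> A \<Longrightarrow> f i \<in> integral_elements) \<Longrightarrow> prod f A \<in> integral_elements"
  by (induction A rule: infinite_finite_induct) (auto intro: integral_elements_mult)

lemma eval_fract_integral:
  assumes "x \<in> standard_lattice"
  shows "eval_fract q x \<in> integral_elements"
  using assms unfolding eval_fract_def standard_lattice_def
  by (auto intro!: integral_elements_sum integral_elements_mult integral_elements_prod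
      integral_elements_power)

section \<open>Quadratic forms and their polar forms\<close>

lemma monomial_factor_out:
  fixes m :: "'n::finite \<Rightarrow> nat"
  assumes "sum m UNIV = Suc d"
  obtains i m' where "sum m' UNIV = d"
    "\<And>x :: 'n \<Rightarrow> 'a::comm_monoid_mult. (\<Prod>k\<in>UNIV. x k ^ m k) = x i * (\<Prod>k\<in>UNIV. x k ^ m' k)"
proof -
  obtain i where i: "m i \<noteq> 0"
    using assms by (metis sum.neutral nat.distinct(1))
  define m' where "m' = m(i := m i - 1)"
  have rest: "m' k = m k" if "k \<in> UNIV - {i}" for k
    using that by (simp add: m'_def)
  have mi: "m i = Suc (m' i)"
    using i by (simp add: m'_def)
  have "sum m UNIV = m i + sum m (UNIV - {i})" "sum m' UNIV = m' i + sum m' (UNIV - {i})"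
    by (simp_all add: sum.remove)
  moreover have "sum m' (UNIV - {i}) = sum m (UNIV - {i})"
    using rest by (intro sum.cong) auto
  ultimately have "sum m' UNIV = d"
    using mi assms by simp
  moreover have "(\<Prod>k\<in>UNIV. x k ^ m k) = x i * (\<Prod>k\<in>UNIV. x k ^ m' k)"
    for x :: "'n \<Rightarrow> 'a"
  proof -
    have "(\<Prod>k\<in>UNIV - {i}. x k ^ m k) = (\<Prod>k\<in>UNIV - {i}. x k ^ m' k)"
      using rest by (intro prod.cong) auto
    then show ?thesis
      by (simp add: prod.remove[of UNIV i] mi ac_simps)
  qed
  ultimately show ?thesis
    by (rule that)
qed

lemma degree_2_monomial:
  fixes m :: "'n::finite \<Rightarrow> nat"
  assumes "sum m UNIV = 2"
  obtains i j where "\<And>x :: 'n \<Rightarrow> 'a::comm_monoid_mult. (\<Prod>k\<in>UNIV. x k ^ m k) = x i * x j"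
proof -
  from assms have "sum m UNIV = Suc 1" by simp
  then obtain i m' where m': "sum m' UNIV = 1"
    "\<And>x :: 'n \<Rightarrow> 'a. (\<Prod>k\<in>UNIV. x k ^ m k) = x i * (\<Prod>k\<in>UNIV. x k ^ m' k)"
    using monomial_factor_out by blast
  from m'(1) have "sum m' UNIV = Suc 0" by simp
  then obtain j m'' where m'': "sum m'' UNIV = 0"
    "\<And>x :: 'n \<Rightarrow> 'a. (\<Prod>k\<in>UNIV. x k ^ m' k) = x j * (\<Prod>k\<in>UNIV. x k ^ m'' k)"
    using monomial_factor_out by blast
  have "(\<Prod>k\<in>UNIV. x k ^ m k) = x i * x j" for x :: "'n \<Rightarrow> 'a"
    using m''(1) by (simp add: m'(2) m''(2))
  then show ?thesis
    by (rule that)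
qed

text \<open>
  Both sides are linear in the coefficients of \<open>q\<close>, so the identity is checked on the monomials
  \<open>x\<^sub>i x\<^sub>j\<close>. It contains all that is needed of the bilinearity of the polar form.
\<close>

lemma eval_fract_add_scale:
  fixes q :: "('n::finite, 'r::idom) polynomial"
  assumes "quadratic_form q"
  shows "eval_fract q (y + c *s x) =
    eval_fract q y + c * polar_form (eval_fract q) y x + c\<^sup>2 * eval_fract q x"
proof -
  define t where "t m z = to_fract (Poly_Mapping.lookup q m) *
    (\<Prod>i\<in>UNIV. (z $ i) ^ Poly_Mapping.lookup m i)" for m and z :: "'r fract ^ 'n"
  have eval: "eval_fract q z = (\<Sum>m\<in>Poly_Mapping.keys q. t m z)" for z
    by (simp add: eval_fract_def t_def)
  have "t m (y + c *s x) = t m y + c * (t m (y + x) - t m y - t m x) + c\<^sup>2 * t m x"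
    if m: "m \<in> Poly_Mapping.keys q" for m
  proof -
    have "sum (Poly_Mapping.lookup m) UNIV = 2"
      using assms m by (simp add: quadratic_form_def homogeneous_of_degree_def)
    then obtain i j where "\<And>z :: 'n \<Rightarrow> 'r fract.
        (\<Prod>k\<in>UNIV. z k ^ Poly_Mapping.lookup m k) = z i * z j"
      using degree_2_monomial by blast
    then have "t m z = to_fract (Poly_Mapping.lookup q m) * (z $ i * z $ j)" for z
      by (simp add: t_def)
    then show ?thesis
      by (simp add: algebra_simps power2_eq_square)
  qed
  then show ?thesis
    by (simp add: eval polar_form_def sum.distrib sum_subtractf flip: sum_distrib_left)
qed

lemma polar_form_eq_diff:
  assumes "quadratic_form q"
  shows "polar_form (eval_fract q) y x = eval_fract q y + eval_fract q x - eval_fract q (x - y)"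
  using eval_fract_add_scale[OF assms, of x "-1" y]
  by (simp add: polar_form_def algebra_simps)

section \<open>Maximality of the standard lattice\<close>

lemma subspace_standard_lattice: "fract_module.subspace standard_lattice"
  by (auto simp: fract_module.subspace_def standard_lattice_def fract_scale_def
      intro: integral_elements_add integral_elements_mult)

lemma span_axis_standard_lattice:
  "fract_module.span (range (\<lambda>i. axis i 1)) = (standard_lattice :: ('r::idom fract ^ 'n::finite) set)"
proof
  have "range (\<lambda>i. axis i 1) \<subseteq> (standard_lattice :: ('r fract ^ 'n) set)"
    by (auto simp: standard_lattice_def axis_def)
  then show "fract_module.span (range (\<lambda>i. axis i 1)) \<subseteq> (standard_lattice :: ('r fract ^ 'n) set)"
    by (rule fract_module.span_minimal) (rule subspace_standard_lattice)
  show "(standard_lattice :: ('r fract ^ 'n) set) \<subseteq> fract_module.span (range (\<lambda>i. axis i 1))"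
  proof
    fix x :: "'r fract ^ 'n"
    assume "x \<in> standard_lattice"
    then have "\<forall>i. \<exists>r. x $ i = to_fract r"
      by (auto simp: standard_lattice_def integral_elements_def)
    then obtain r where r: "\<And>i. x $ i = to_fract (r i)"
      by metis
    have "x = (\<Sum>i\<in>UNIV. x $ i *s axis i 1)"
      by (simp add: basis_expansion)
    also have "\<dots> = (\<Sum>i\<in>UNIV. fract_scale (r i) (axis i 1))"
      by (simp add: r fract_scale_def)
    also have "\<dots> \<in> fract_module.span (range (\<lambda>i. axis i 1))"
      by (intro fract_module.span_sum fract_module.span_scale fract_module.span_base) auto
    finally show "x \<in> fract_module.span (range (\<lambda>i. axis i 1))" .
  qed
qed

lemma span_standard_lattice: "fract_module.span standard_lattice = standard_lattice"
  using subspace_standard_lattice by (rule fract_module.span_eq_iff[THEN iffD2])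

text \<open>The span of \<open>\<Lambda> \<union> {x}\<close> is \<open>\<Lambda> + R x\<close>, which is generated by the unit vectors and \<open>x\<close>.\<close>

lemma lattice_in_span_insert:
  "lattice_in (fract_module.span (insert x standard_lattice))"
proof -
  let ?L = "fract_module.span (insert x standard_lattice)"
  have "?L = fract_module.span (insert x (range (\<lambda>i. axis i 1)))"
    unfolding span_axis_standard_lattice[symmetric]
    by (auto simp: fract_module.span_breakdown_eq fract_module.span_span)
  then have "\<exists>S. finite S \<and> fract_module.span S = ?L"
    by (intro exI[of _ "insert x (range (\<lambda>i. axis i 1))"]) auto
  moreover have "range (\<lambda>i. axis i 1) \<subseteq> ?L"
    by (auto intro!: fract_module.span_base simp: standard_lattice_def axis_def)
  then have "vec.span ?L = UNIV"
    using vec.span_mono[of "range (\<lambda>i. axis i 1)" ?L] vec.span_Basis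
    by (auto simp: cart_basis_def full_SetCompr_eq)
  ultimately show ?thesis
    by (simp add: lattice_in_def fract_module.subspace_span)
qed

lemma lattice_in_standard_lattice: "lattice_in (standard_lattice :: ('r::idom fract ^ 'n::finite) set)"
proof -
  have "0 \<in> (standard_lattice :: ('r fract ^ 'n) set)"
    by (simp add: standard_lattice_def)
  then show ?thesis
    using lattice_in_span_insert[of "0 :: 'r fract ^ 'n"]
    by (simp only: insert_absorb span_standard_lattice)
qed

lemma quadratic_lattice_standard_lattice: "quadratic_lattice (eval_fract q) standard_lattice"
  by (auto simp: quadratic_lattice_def lattice_in_standard_lattice eval_fract_integral)

lemma maximal_standard_lattice_iff:
  assumes q: "quadratic_form q"
  shows "maximal_quadratic_lattice (eval_fract q) standard_lattice \<longleftrightarrow>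
    (\<forall>x. x \<notin> standard_lattice \<longrightarrow>
      (\<exists>y\<in>standard_lattice. eval_fract q (x - y) \<notin> integral_elements))"
    (is "?max \<longleftrightarrow> ?sep")
proof
  assume max: ?max
  show ?sep
  proof (intro allI impI, rule ccontr)
    fix x
    assume x: "x \<notin> standard_lattice"
      and "\<not> (\<exists>y\<in>standard_lattice. eval_fract q (x - y) \<notin> integral_elements)"
    then have int: "eval_fract q (x - y) \<in> integral_elements" if "y \<in> standard_lattice" for y
      using that by blast
    have qx: "eval_fract q x \<in> integral_elements"
      using int[of 0] by (simp add: standard_lattice_def)
    let ?L = "fract_module.span (insert x standard_lattice)"
    have "eval_fract q z \<in> integral_elements" if "z \<in> ?L" for z
    proof -
      obtain r where r: "z - fract_scale r x \<in> standard_lattice"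
        using \<open>z \<in> ?L\<close> unfolding fract_module.span_breakdown_eq span_standard_lattice by blast
      define y where "y = z - fract_scale r x"
      have y: "y \<in> standard_lattice" "z = y + to_fract r *s x"
        using r by (simp_all add: y_def fract_scale_def)
      have "polar_form (eval_fract q) y x \<in> integral_elements"
        unfolding polar_form_eq_diff[OF q]
        by (intro integral_elements_add integral_elements_diff int qx eval_fract_integral y)
      then show ?thesis
        unfolding y(2) eval_fract_add_scale[OF q]
        by (intro integral_elements_add integral_elements_mult integral_elements_power
            eval_fract_integral qx y to_fract_in_integral_elements)
    qed
    then have "quadratic_lattice (eval_fract q) ?L"
      by (auto simp: quadratic_lattice_def lattice_in_span_insert)
    moreover have "standard_lattice \<subset> ?L"
      using x fract_module.span_superset[of "insert x standard_lattice"] by blast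
    ultimately show False
      using max by (auto simp: maximal_quadratic_lattice_def)
  qed
next
  assume sep: ?sep
  have "\<not> standard_lattice \<subset> L" if L: "quadratic_lattice (eval_fract q) L" for L
  proof
    assume sub: "standard_lattice \<subset> L"
    then obtain x where x: "x \<in> L" "x \<notin> standard_lattice"
      by blast
    then obtain y where y: "y \<in> standard_lattice" "eval_fract q (x - y) \<notin> integral_elements"
      using sep by blast
    have "x - y \<in> L"
      using L x y sub by (auto simp: quadratic_lattice_def lattice_in_def
          intro!: fract_module.subspace_diff)
    then show False
      using L y by (auto simp: quadratic_lattice_def)
  qed
  then show ?max
    by (auto simp: maximal_quadratic_lattice_def quadratic_lattice_standard_lattice)
qed

section \<open>The norm condition\<close>

lemma valuation_norm_between_0_1_iff:
  assumes "discrete_valuation_ring v" and "a \<ge> 2"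
  shows "0 < valuation_norm a v z \<and> valuation_norm a v z < 1 \<longleftrightarrow> z \<notin> integral_elements"
proof -
  have "z \<in> integral_elements \<longleftrightarrow> z = 0 \<or> v z \<ge> 0"
    using assms(1) by (auto simp: discrete_valuation_ring_def valuation_ring_def)
  moreover have "real_of_int a powi v z < 1 \<longleftrightarrow> v z < 0"
    using assms(2) power_int_strict_increasing[of "v z" 0 "real_of_int a"]
      one_le_power_int[of "real_of_int a" "v z"]
    by (auto simp: not_less[symmetric])
  ultimately show ?thesis
    using assms(2) by (auto simp: valuation_norm_def)
qed

theorem theorem19:
  fixes v :: "'r::idom fract \<Rightarrow> int"
    and a :: int
    and q :: "('n::finite, 'r) polynomial"
  assumes "complete_discrete_valuation_ring v"
    and "CHAR('r fract) \<noteq> 2"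
    and "a \<ge> 2"
    and "quadratic_form q"
    and "nondegenerate (eval_fract q)"
  shows "Euclidean_form (valuation_norm a v) q \<longleftrightarrow>
         maximal_quadratic_lattice (eval_fract q) standard_lattice"
proof -
  have "discrete_valuation_ring v"
    using assms(1) by (simp add: complete_discrete_valuation_ring_def)
  then show ?thesis
    unfolding Euclidean_form_def maximal_standard_lattice_iff[OF assms(4)]
    using valuation_norm_between_0_1_iff[OF _ assms(3), of v] by simp
qed

end
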